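(* For any integer $p\ge3$ $$\mathcal{M}^{\mathrm{EE}}_p(\mathcal{S}_p\cap\mathbb{C}_{-,0})\le\frac{\left(\frac{1.95}{W(1/e)}\right)^p}{3.9\,\pi\sqrt{p-1}}<\frac{7.01^p}{3.9\,\pi\sqrt{p-1}}.$$
   Context: Explicit Euler (EE) extrapolation of order $p\ge2$ on the test equation $U'=\lambda U$, with $z=\tau\lambda\in\mathbb{C}$ and internal perturbations: given $U_n$ and residuals $\tilde r_{m,j}\in\mathbb{C}$ ($1\le m\le p$, $1\le j\le m$), set $$\widetilde Y_{m,0}=U_n,\qquad \widetilde Y_{m,j}=\Big(1+\frac zm\Big)\widetilde Y_{m,j-1}+\tilde r_{m,j}\ (1\le j\le m),\qquad T_{m,1}=\widetilde Y_{m,m},$$ $$T_{j,k}=T_{j,k-1}+\frac{T_{j,k-1}-T_{j-1,k-1}}{\frac{j}{j-k+1}-1}\quad(2\le k\le j\le p),\qquad U_{n+1}=T_{p,p}.$$ Then $U_{n+1}=P(z)U_n+\sum_{m=1}^p\sum_{\ell=1}^mQ^{\mathrm{EE}}_{p,m,\ell}(z)\,\tilde r_{m,\ell}$, which defines the internal stability polynomials $Q^{\mathrm{EE}}_{p,m,\ell}$. For $\mathcal{S}\subset\mathbb{C}$, $$\mathcal{M}^{\mathrm{EE}}_p(\mathcal{S}):=\max_{1\le m\le p}\max_{1\le\ell\le m}\sup_{z\in\mathcal{S}}|Q^{\mathrm{EE}}_{p,m,\ell}(z)|.$$ The absolute stability region of the method is $\mathcal{S}_p=\{z\in\mathbb{C}:|\sum_{k=0}^pz^k/k!|\le1\}$,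 and $\mathbb{C}_{-,0}=\{z\in\mathbb{C}:\operatorname{Re}z\le0\}$. $W$ is the Lambert function: for $x\ge-1/e$, $W(x)\ge-1$ is the unique number with $W(x)e^{W(x)}=x$. *)

theory Defs
  imports "HOL-Analysis.Analysis"
begin

text \<open>One step of explicit Euler extrapolation with the harmonic step sequence for
  \<open>U' = \<lambda> U\<close>, where \<open>z = \<tau> \<lambda>\<close>, \<open>u\<close> is the value \<open>U\<^sub>n\<close> and \<open>r m j\<close> is the residual
  added in the \<open>j\<close>-th internal Euler step of size \<open>\<tau>/m\<close>.\<close>

primrec ee_Y :: "complex \<Rightarrow> complex \<Rightarrow> (nat \<Rightarrow> nat \<Rightarrow> complex) \<Rightarrow> nat \<Rightarrow> nat \<Rightarrow> complex" where
  "ee_Y z u r m 0 = u"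
| "ee_Y z u r m (Suc j) = (1 + z / of_nat m) * ee_Y z u r m j + r m (Suc j)"

text \<open>The extrapolation table \<open>T\<^sub>j\<^sub>,\<^sub>k\<close> is only meaningful for \<open>1 \<le> k \<le> j\<close>; column \<open>0\<close> is a dummy
  value that never enters an entry in this range. In the last equation the column
  index is \<open>k + 2\<close>, so that \<open>j - k + 1\<close> of the usual formula reads \<open>j - (k + 2) + 1\<close>.\<close>

fun ee_T :: "complex \<Rightarrow> complex \<Rightarrow> (nat \<Rightarrow> nat \<Rightarrow> complex) \<Rightarrow> nat \<Rightarrow> nat \<Rightarrow> complex" where
  "ee_T z u r j 0 = 0"
| "ee_T z u r j (Suc 0) = ee_Y z u r j j"
| "ee_T z u r j (Suc (Suc k)) =
     ee_T z u r j (Suc k) +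
     (ee_T z u r j (Suc k) - ee_T z u r (j - 1) (Suc k)) /
       (of_nat j / (of_nat j - of_nat (Suc (Suc k)) + 1) - 1)"

definition ee_step :: "nat \<Rightarrow> complex \<Rightarrow> complex \<Rightarrow> (nat \<Rightarrow> nat \<Rightarrow> complex) \<Rightarrow> complex" where
  "ee_step p z u r = ee_T z u r p p"

definition ee_expansion :: "nat \<Rightarrow> complex poly \<Rightarrow> (nat \<Rightarrow> nat \<Rightarrow> complex poly) \<Rightarrow> bool" where
  "ee_expansion p P Q \<longleftrightarrow>
     (\<forall>z u r. ee_step p z u r =
        poly P z * u + (\<Sum>m=1..p. \<Sum>l=1..m. poly (Q m l) z * r m l))"

text \<open>The internal stability polynomials. The description is well defined exactly for indices
  \<open>1 \<le> l \<le> m \<le> p\<close>; see \<open>ee_expansion_exists\<close>, \<open>ee_expansion_unique\<close> and \<open>ee_step_eq\<close>.\<close>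

definition ee_Q :: "nat \<Rightarrow> nat \<Rightarrow> nat \<Rightarrow> complex poly" where
  "ee_Q p m l = (THE q. \<exists>P Q. ee_expansion p P Q \<and> q = Q m l)"

text \<open>The supremum is taken in the extended reals, so that it is \<open>\<infinity>\<close>, and not an unspecified
  number, when a stability polynomial is unbounded on \<open>S\<close>.\<close>

definition ee_M :: "nat \<Rightarrow> complex set \<Rightarrow> ereal" where
  "ee_M p S =
     (MAX m\<in>{1..p}. MAX l\<in>{1..m}. SUP z\<in>S. ereal (cmod (poly (ee_Q p m l) z)))"

definition stab_region :: "nat \<Rightarrow> complex set" where
  "stab_region p = {z. cmod (\<Sum>k=0..p. z ^ k / fact k) \<le> 1}"

definition left_half_plane :: "complex set" where
  "left_half_plane = {z. Re z \<le> 0}"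

text \<open>The principal branch on \<open>x \<ge> - 1 / e\<close>.\<close>

definition Lambert_W :: "real \<Rightarrow> real" where
  "Lambert_W x = (THE w. w \<ge> -1 \<and> w * exp w = x)"

lemma Lambert_W_ex1:
  assumes "x \<ge> - 1 / exp (1::real)"
  shows "\<exists>!w::real. w \<ge> -1 \<and> w * exp w = x"
proof -
  have strict: "v * exp v < w * exp w" if "-1 \<le> v" "v < w" for v w :: real
  proof -
    have "(\<lambda>t. t * exp t) v < (\<lambda>t. t * exp t) w"
    proof (rule DERIV_pos_imp_increasing_open[OF \<open>v < w\<close>])
      fix t assume "v < t" "t < w"
      have "((\<lambda>t. t * exp t) has_real_derivative (1 + t) * exp t) (at t)"
        by (auto intro!: derivative_eq_intros simp: algebra_simps)
      moreover have "(1 + t) * exp t > 0" using \<open>v < t\<close> that by simp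
      ultimately show "\<exists>y. ((\<lambda>t. t * exp t) has_real_derivative y) (at t) \<and> y > 0" by blast
    qed (intro continuous_intros)
    then show ?thesis by simp
  qed
  have "\<exists>w. -1 \<le> w \<and> w \<le> max x 0 \<and> w * exp w = x"
  proof (rule IVT')
    show "- 1 * exp (- 1) \<le> x" using assms by (simp add: exp_minus field_simps)
    have "max x 0 * 1 \<le> max x 0 * exp (max x 0)" by (intro mult_left_mono) auto
    then show "x \<le> max x 0 * exp (max x 0)" by linarith
  qed (auto intro!: continuous_intros)
  moreover have "v = w" if "v \<ge> -1" "w \<ge> -1" "v * exp v = w * exp w" for v w :: real
    using strict[of v w] strict[of w v] that by (cases v w rule: linorder_cases) auto
  ultimately show ?thesis by metis
qed

lemma ee_Y_eq:
  "ee_Y z u r m j = (1 + z / of_nat m) ^ j * u +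
     (\<Sum>l=1..j. (1 + z / of_nat m) ^ (j - l) * r m l)"
proof (induction j)
  case (Suc j)
  have "(\<Sum>l=1..j. (1 + z / of_nat m) ^ (Suc j - l) * r m l) =
        (1 + z / of_nat m) * (\<Sum>l=1..j. (1 + z / of_nat m) ^ (j - l) * r m l)"
    unfolding sum_distrib_left by (intro sum.cong) (auto simp: Suc_diff_le)
  then show ?case using Suc by (simp add: algebra_simps)
qed simp

lemma ee_T_expansion:
  assumes "1 \<le> k" "k \<le> j" "j \<le> p"
  shows "\<exists>P Q. \<forall>z u r. ee_T z u r j k =
           poly P z * u + (\<Sum>m=1..p. \<Sum>l=1..m. poly (Q m l) z * r m l)"
  using assms
proof (induction k arbitrary: j rule: less_induct)
  case (less k)
  show ?case
  proof (cases "k = 1")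
    case True
    define a where "a = [:1, 1 / of_nat j :: complex:]"
    have a: "poly a z = 1 + z / of_nat j" for z by (simp add: a_def)
    define Q where "Q = (\<lambda>m l. if m = j then a ^ (j - l) else 0)"
    have "ee_T z u r j k =
        poly (a ^ j) z * u + (\<Sum>m=1..p. \<Sum>l=1..m. poly (Q m l) z * r m l)" for z u r
    proof -
      have "(\<Sum>m=1..p. \<Sum>l=1..m. poly (Q m l) z * r m l) =
            (\<Sum>m=1..p. if m = j then \<Sum>l=1..j. poly (a ^ (j - l)) z * r j l else 0)"
        by (intro sum.cong) (auto simp: Q_def)
      also have "\<dots> = (\<Sum>l=1..j. poly (a ^ (j - l)) z * r j l)"
        using less.prems by simp
      finally show ?thesis using True by (simp add: ee_Y_eq a poly_power)
    qed
    then show ?thesis by blast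
  next
    case False
    then obtain k' where k: "k = Suc (Suc k')"
      using less.prems by (metis One_nat_def not0_implies_Suc not_one_le_zero)
    define c :: complex where "c = of_nat j / (of_nat j - of_nat k + 1) - 1"
    obtain P Q where 1: "\<And>z u r. ee_T z u r j (Suc k') =
        poly P z * u + (\<Sum>m=1..p. \<Sum>l=1..m. poly (Q m l) z * r m l)"
      using less.IH[of "Suc k'" j] less.prems k by auto
    obtain P' Q' where 2: "\<And>z u r. ee_T z u r (j - 1) (Suc k') =
        poly P' z * u + (\<Sum>m=1..p. \<Sum>l=1..m. poly (Q' m l) z * r m l)"
      using less.IH[of "Suc k'" "j - 1"] less.prems k by fastforce
    define A where "A = P + smult (1 / c) (P - P')"
    define B where "B = (\<lambda>m l. Q m l + smult (1 / c) (Q m l - Q' m l))"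
    have "ee_T z u r j k =
        poly A z * u + (\<Sum>m=1..p. \<Sum>l=1..m. poly (B m l) z * r m l)" for z u r
    proof -
      have T: "ee_T z u r j k = ee_T z u r j (Suc k') +
          1 / c * (ee_T z u r j (Suc k') - ee_T z u r (j - 1) (Suc k'))"
        by (simp add: k c_def)
      have B: "(\<Sum>m=1..p. \<Sum>l=1..m. poly (B m l) z * r m l) =
          (\<Sum>m=1..p. \<Sum>l=1..m. poly (Q m l) z * r m l) +
          1 / c * ((\<Sum>m=1..p. \<Sum>l=1..m. poly (Q m l) z * r m l) -
                   (\<Sum>m=1..p. \<Sum>l=1..m. poly (Q' m l) z * r m l))"
        unfolding sum_distrib_left sum_subtractf[symmetric] sum.distrib[symmetric]
        by (intro sum.cong) (auto simp: B_def algebra_simps diff_divide_distrib)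
      show ?thesis unfolding T B 1 2 by (simp add: A_def algebra_simps diff_divide_distrib)
    qed
    then show ?thesis by blast
  qed
qed

lemma ee_expansion_exists:
  assumes "p \<ge> 1"
  shows "\<exists>P Q. ee_expansion p P Q"
  using ee_T_expansion[of p p p] assms by (simp add: ee_expansion_def ee_step_def)

lemma ee_expansion_unit:
  assumes "ee_expansion p P Q" "1 \<le> l" "l \<le> m" "m \<le> p"
  shows "poly (Q m l) z = ee_step p z 0 (\<lambda>m' l'. if m' = m \<and> l' = l then 1 else 0)"
proof -
  have "(\<Sum>m'=1..p. \<Sum>l'=1..m'. poly (Q m' l') z * (if m' = m \<and> l' = l then 1 else 0)) =
        (\<Sum>m'=1..p. if m' = m then (\<Sum>l'=1..m. if l' = l then poly (Q m l) z else 0) else 0)"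
    by (intro sum.cong refl) (auto simp: if_distrib[of "\<lambda>x. _ * x"] intro!: sum.neutral cong: if_cong)
  also have "\<dots> = poly (Q m l) z" using assms by simp
  finally show ?thesis using assms(1) by (simp add: ee_expansion_def)
qed

lemma ee_expansion_unique:
  assumes "ee_expansion p P Q" "ee_expansion p P' Q'" "1 \<le> l" "l \<le> m" "m \<le> p"
  shows "Q m l = Q' m l"
  using ee_expansion_unit[OF assms(1,3-5)] ee_expansion_unit[OF assms(2-5)]
  by (simp add: poly_eq_poly_eq_iff[symmetric] fun_eq_iff)

lemma ee_Q_eq:
  assumes "ee_expansion p P Q" "1 \<le> l" "l \<le> m" "m \<le> p"
  shows "ee_Q p m l = Q m l"
  unfolding ee_Q_def using ee_expansion_unique[OF _ _ assms(2-4)] assms(1)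
  by (intro the_equality) blast+

lemma ee_step_eq:
  assumes "p \<ge> 1"
  shows "\<exists>P. \<forall>z u r. ee_step p z u r =
           poly P z * u + (\<Sum>m=1..p. \<Sum>l=1..m. poly (ee_Q p m l) z * r m l)"
proof -
  obtain P Q where PQ: "ee_expansion p P Q" using ee_expansion_exists[OF assms] by blast
  have "(\<Sum>m=1..p. \<Sum>l=1..m. poly (ee_Q p m l) z * r m l) =
        (\<Sum>m=1..p. \<Sum>l=1..m. poly (Q m l) z * r m l)" for z r
    by (intro sum.cong refl) (auto simp: ee_Q_eq[OF PQ])
  then show ?thesis using PQ by (auto simp: ee_expansion_def)
qed

end

theory Submission
  imports Defs
begin

text \<open>
  The extrapolated value is the Lagrange interpolant of the Euler results in \<open>h = 1/m\<close>, evaluated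
  at \<open>h = 0\<close>. Hence \<open>T\<^sub>p\<^sub>,\<^sub>p\<close> is a fixed linear combination of \<open>T\<^sub>1\<^sub>,\<^sub>1, \<dots>, T\<^sub>p\<^sub>,\<^sub>1\<close>, and since a
  residual entering at the \<open>l\<close>-th step of the \<open>m\<close>-th Euler run is multiplied by \<open>1 + z/m\<close> in each
  of the remaining \<open>m - l\<close> steps (\<open>ee_Q_closed_form\<close>),
  \<open>\<bar>Q\<^sub>p\<^sub>,\<^sub>m\<^sub>,\<^sub>l(z)\<bar> = m\<^sup>p / (m! (p-m)!) * \<bar>1 + z/m\<bar>\<^bsup>m-l\<^esup>\<close>.
  The two factors are bounded separately.

  The power of \<open>1 + z/m\<close> contributes a factor below \<open>1.95\<^bsup>p-1\<^esup>\<close>. A point of the stability region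
  satisfies \<open>\<bar>z\<bar> \<le> 6p/5\<close> (\<open>stab_region_norm_le\<close>): on a circle of radius \<open>6p/5\<close> or more the modulus of
  the exponential partial sum is bounded below by a fixed multiple of its value at the positive
  point of that circle, and this value is large. In the left half-plane
  \<open>\<bar>1 + z/m\<bar>\<^sup>2 \<le> 1 + (\<bar>z\<bar>/m)\<^sup>2 \<le> exp (\<bar>z\<bar>/m)\<close>, so that the power is at most \<open>exp (3(p-1)/5)\<close>
  whatever \<open>m\<close> is (\<open>euler_amplification_le\<close>), and \<open>exp (3/5) < 1.95\<close>.

  The interpolation weight contributes the factor \<open>W(1/e)\<^bsup>-p\<^esup>\<close>. With \<open>m = xp\<close>, Stirling's formula
  gives the exponential growth rate \<open>e (x/(1-x))\<^bsup>1-x\<^esup>\<close>. It is stationary where \<open>y = (1-x)/x\<close> solves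
  \<open>y exp y = 1/e\<close>, that is at \<open>y = W(1/e)\<close>, and its maximum is \<open>1/W(1/e)\<close>
  (\<open>power_le_power_times_exp\<close>). The remaining square roots in Stirling's formula give
  \<open>1/\<surd>(m(p-m)) \<le> 1/\<surd>(p-1)\<close> for \<open>m < p\<close>; for \<open>m = p\<close> the growth is only \<open>e\<^sup>p\<close>, which is smaller by
  an exponential factor (\<open>extrapolation_weight_le\<close>).

  The bound \<open>1/W(1/e) < 701/195\<close> and the comparison of the constants are numerical; the gap between
  \<open>exp (3/5)\<close> and \<open>1.95\<close> leaves enough room for rational approximations.
\<close>

section \<open>The internal stability polynomials in closed form\<close>

text \<open>The entry in column \<open>n + 1\<close> interpolates the \<open>n + 1\<close> nodes \<open>1/(j-n), \<dots>, 1/j\<close>; the Lagrange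
  weight of the node \<open>1/m\<close> at \<open>0\<close> is the product of \<open>m/(m-i)\<close> over the other nodes \<open>1/i\<close>.
  The induction is the Aitken-Neville recursion; in terms of the binomial coefficients it amounts
  to Pascal's rule and the absorption identity.\<close>

lemma ee_T_closed_form:
  assumes "n < j"
  shows "ee_T z u r j (Suc n) =
    (\<Sum>i\<le>n. (-1) ^ i * of_nat (n choose i) * of_nat (j - i) ^ n / fact n * ee_Y z u r (j - i) (j - i))"
  using assms
proof (induction n arbitrary: j)
  case (Suc n)
  define Y where "Y = (\<lambda>i. of_nat (j - i) ^ n / fact n * ee_Y z u r (j - i) (j - i))"
  define A where "A = ee_T z u r j (Suc n)"
  define B where "B = ee_T z u r (j - 1) (Suc n)"
  have A: "A = (\<Sum>i\<le>Suc n. (-1) ^ i * of_nat (n choose i) * Y i)"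
    using Suc.IH[of j] Suc.prems by (simp add: A_def Y_def mult.assoc)
  \<comment> \<open>The \<open>i\<close>-th node of row \<open>j - 1\<close> is the \<open>(i+1)\<close>-st node of row \<open>j\<close>; the shift costs a sign.\<close>
  have B: "- B = (\<Sum>i\<le>Suc n. (-1) ^ i * of_nat (if i = 0 then 0 else n choose (i - 1)) * Y i)"
    using Suc.IH[of "j - 1"] Suc.prems unfolding B_def Y_def sum.atMost_Suc_shift
    by (simp add: mult.assoc sum_negf)
  have step: "of_nat j * of_nat (n choose i) +
      (of_nat j - of_nat (Suc n)) * of_nat (if i = 0 then 0 else n choose (i - 1)) =
      (of_nat (j - i) * of_nat (Suc n choose i) :: complex)" if "i \<le> Suc n" for i
  proof (cases i)
    case (Suc k)
    have "real (Suc k) * real (Suc n choose Suc k) = real (Suc n) * real (n choose k)"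
      by (metis Suc_times_binomial of_nat_mult)
    then have *: "of_nat (Suc k) * of_nat (Suc n choose Suc k) = (of_nat (Suc n) * of_nat (n choose k) :: complex)"
      by (metis of_nat_eq_iff of_nat_mult)
    have "of_nat (Suc n choose Suc k) = (of_nat (n choose k) + of_nat (n choose Suc k) :: complex)"
      by simp
    moreover have "of_nat (j - i) = (of_nat j - of_nat (Suc k) :: complex)"
      using Suc that \<open>Suc n < j\<close> by (simp add: of_nat_diff)
    moreover have "of_nat (Suc k) = (of_nat k + 1 :: complex)"
        "of_nat (Suc n) = (of_nat n + 1 :: complex)" by simp_all
    ultimately show ?thesis using * unfolding Suc by simp algebra
  qed simp
  have nz: "(of_nat j - of_nat (Suc n) :: complex) \<noteq> 0" "(of_nat (Suc n) :: complex) \<noteq> 0"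
    using Suc.prems by (metis less_irrefl eq_iff_diff_eq_0 of_nat_eq_iff, simp del: of_nat_Suc)
  have "ee_T z u r j (Suc (Suc n)) =
      A + (A - B) / (of_nat j / (of_nat j - of_nat (Suc n)) - 1)"
    by (simp add: A_def B_def)
  also have "of_nat j / (of_nat j - of_nat (Suc n)) - 1 =
      (of_nat (Suc n) / (of_nat j - of_nat (Suc n)) :: complex)"
    using nz by (simp add: field_simps)
  also have "A + (A - B) / (of_nat (Suc n) / (of_nat j - of_nat (Suc n))) =
      (of_nat j * A + (of_nat j - of_nat (Suc n)) * (- B)) / of_nat (Suc n)"
    using nz by (simp add: field_simps del: of_nat_Suc)
  also have "of_nat j * A + (of_nat j - of_nat (Suc n)) * (- B) =
      (\<Sum>i\<le>Suc n. (-1) ^ i * (of_nat j * of_nat (n choose i) +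
      (of_nat j - of_nat (Suc n)) * of_nat (if i = 0 then 0 else n choose (i - 1))) * Y i)"
    unfolding A B sum_distrib_left sum.distrib[symmetric]
    by (intro sum.cong refl) (simp add: algebra_simps)
  also have "\<dots> = (\<Sum>i\<le>Suc n. (-1) ^ i * (of_nat (j - i) * of_nat (Suc n choose i)) * Y i)"
    using step by (intro sum.cong refl) simp
  finally show ?case
    unfolding sum_divide_distrib Y_def
    by (simp add: mult_ac)
qed simp

text \<open>A unit residual at position \<open>(m, l)\<close> reaches only the \<open>m\<close>-th Euler run, so a single term of the
  Lagrange sum survives.\<close>

lemma ee_Q_closed_form:
  assumes "1 \<le> l" "l \<le> m" "m \<le> p"
  shows "poly (ee_Q p m l) z = (-1) ^ (p - m) * of_nat m ^ p / (fact m * fact (p - m))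
           * (1 + z / of_nat m) ^ (m - l)"
proof -
  define r :: "nat \<Rightarrow> nat \<Rightarrow> complex" where "r = (\<lambda>m' l'. if m' = m \<and> l' = l then 1 else 0)"
  obtain q where q: "p = Suc q" using assms by (cases p) auto
  have Y: "ee_Y z 0 r k k = (if k = m then (1 + z / of_nat m) ^ (m - l) else 0)" for k
    using assms by (auto simp: ee_Y_eq r_def if_distrib[of "\<lambda>x. _ * x"] cong: if_cong)
  obtain P Q where PQ: "ee_expansion p P Q" using ee_expansion_exists[of p] assms by auto
  have "poly (ee_Q p m l) z = ee_T z 0 r p (Suc q)"
    using ee_expansion_unit[OF PQ assms] ee_Q_eq[OF PQ assms] q by (simp add: ee_step_def r_def)
  also have "\<dots> = (\<Sum>i\<le>q. (-1) ^ i * of_nat (q choose i) * of_nat (p - i) ^ q / fact q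
      * ee_Y z 0 r (p - i) (p - i))"
    by (rule ee_T_closed_form) (simp add: q)
  also have "\<dots> = (\<Sum>i\<le>q. if i = p - m then (-1) ^ i * of_nat (q choose i) * of_nat m ^ q / fact q
      * (1 + z / of_nat m) ^ (m - l) else 0)"
    unfolding Y using assms q by (intro sum.cong refl) auto
  also have "\<dots> = (-1) ^ (p - m) * (of_nat (q choose (p - m)) / fact q * of_nat m ^ q)
      * (1 + z / of_nat m) ^ (m - l)"
    using assms q by simp
  also have "of_nat (q choose (p - m)) / fact q * of_nat m ^ q =
      (of_nat m ^ p / (fact m * fact (p - m)) :: complex)"
  proof -
    obtain k where k: "m = Suc k" using assms by (cases m) auto
    have "of_nat (q choose (p - m)) = (fact q / (fact (p - m) * fact (q - (p - m))) :: complex)"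
      using assms q by (intro binomial_fact) auto
    moreover have "q - (p - m) = k" using assms q k by auto
    moreover have "of_nat m / fact m = (1 / fact k :: complex)"
      unfolding k by (simp add: divide_simps del: of_nat_Suc)
    moreover have "(of_nat m ^ p / (fact m * fact (p - m)) :: complex) =
        of_nat m ^ q * (of_nat m / fact m) / fact (p - m)" by (simp add: q)
    ultimately show ?thesis by simp
  qed
  finally show ?thesis by simp
qed

section \<open>The size of the stability region\<close>

text \<open>The product telescopes. For \<open>a = n\<close> all coefficients on the right after the leading one are
  nonpositive and the one of \<open>z\<^sup>n\<close> vanishes.\<close>

lemma linear_factor_times_exp_partial_sum:
  fixes z a :: "'a::field_char_0"
  shows "(z - a) * (\<Sum>k\<le>n. z ^ k / fact k) =
    z ^ Suc n / fact n - (\<Sum>k\<le>n. (a - of_nat k) * z ^ k / fact k)"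
proof (induction n)
  case (Suc n)
  have "(z - a) * (\<Sum>k\<le>Suc n. z ^ k / fact k) =
      z ^ Suc n / fact n - (\<Sum>k\<le>n. (a - of_nat k) * z ^ k / fact k) + (z - a) * (z ^ Suc n / fact (Suc n))"
    using Suc by (simp add: distrib_left)
  moreover have "z ^ Suc n / fact n = of_nat (Suc n) * z ^ Suc n / fact (Suc n)"
    by (simp add: divide_simps del: of_nat_Suc)
  ultimately show ?case by (simp add: diff_divide_distrib algebra_simps)
qed simp

text \<open>In the product with \<open>z - p\<close> the leading coefficient is positive and the others are nonpositive,
  so the reverse triangle inequality bounds the modulus from below by the value of the same
  expression at the positive point \<open>\<bar>z\<bar>\<close>.\<close>

lemma exp_partial_sum_norm_lower:
  fixes z :: complex
  shows "cmod (z - of_nat p) * cmod (\<Sum>k\<le>p. z ^ k / fact k)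
    \<ge> (cmod z - real p) * (\<Sum>k\<le>p. cmod z ^ k / fact k)"
proof -
  have "cmod (\<Sum>k\<le>p. (of_nat p - of_nat k) * z ^ k / fact k)
      \<le> (\<Sum>k\<le>p. (real p - real k) * cmod z ^ k / fact k)"
  proof (rule sum_norm_le)
    fix k assume "k \<in> {..p}"
    then have "cmod (of_nat p - of_nat k) = real p - real k"
      by (metis atMost_iff norm_of_nat of_nat_diff)
    then show "cmod ((of_nat p - of_nat k) * z ^ k / fact k) \<le> (real p - real k) * cmod z ^ k / fact k"
      by (simp add: norm_mult norm_divide norm_power)
  qed
  moreover have "cmod (z ^ Suc p / fact p) = cmod z ^ Suc p / fact p"
    by (simp add: norm_mult norm_divide norm_power)
  moreover have "cmod (z - of_nat p) * cmod (\<Sum>k\<le>p. z ^ k / fact k) =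
      cmod (z ^ Suc p / fact p - (\<Sum>k\<le>p. (of_nat p - of_nat k) * z ^ k / fact k))"
    unfolding norm_mult[symmetric] linear_factor_times_exp_partial_sum ..
  moreover have "cmod (z ^ Suc p / fact p) - cmod (\<Sum>k\<le>p. (of_nat p - of_nat k) * z ^ k / fact k)
      \<le> cmod (z ^ Suc p / fact p - (\<Sum>k\<le>p. (of_nat p - of_nat k) * z ^ k / fact k))"
    by (rule norm_triangle_ineq2)
  moreover have "(cmod z - real p) * (\<Sum>k\<le>p. cmod z ^ k / fact k) =
      cmod z ^ Suc p / fact p - (\<Sum>k\<le>p. (real p - real k) * cmod z ^ k / fact k)"
    by (rule linear_factor_times_exp_partial_sum)
  ultimately show ?thesis by linarith
qed

text \<open>For \<open>\<rho> = \<bar>z\<bar> > 6p/5\<close> the quotient \<open>(\<rho> - p)/(\<rho> + p)\<close> exceeds \<open>1/11\<close>, while already the first three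
  terms of the partial sum at \<open>\<rho> > 18/5\<close> exceed \<open>11\<close>.\<close>

lemma stab_region_norm_le:
  assumes "p \<ge> 3" "z \<in> stab_region p"
  shows "cmod z \<le> 6/5 * real p"
proof (rule ccontr)
  assume "\<not> ?thesis"
  then have big: "cmod z > 6/5 * real p" by simp
  define \<rho> where "\<rho> = cmod z"
  define s where "s = (\<Sum>k\<le>p. \<rho> ^ k / fact k)"
  have \<rho>: "\<rho> > 18/5" "\<rho> > 6/5 * real p" using big assms(1) by (auto simp: \<rho>_def)
  have "11 < 1 + \<rho> + \<rho>\<^sup>2 / 2"
    using \<rho>(1) power_strict_mono[of "18/5" \<rho> 2] by (simp add: power2_eq_square)
  also have "\<dots> = (\<Sum>k\<le>2. \<rho> ^ k / fact k)" by (simp add: eval_nat_numeral)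
  also have "\<dots> \<le> s" unfolding s_def using assms(1) \<rho> by (intro sum_mono2) auto
  finally have "11 * (\<rho> - real p) < s * (\<rho> - real p)" using \<rho> assms(1) by (intro mult_strict_right_mono) auto
  also have "\<dots> \<le> cmod (z - of_nat p) * cmod (\<Sum>k\<le>p. z ^ k / fact k)"
    using exp_partial_sum_norm_lower[of z p] by (simp add: s_def \<rho>_def mult.commute)
  also have "\<dots> \<le> cmod (z - of_nat p) * 1"
    using assms(2) by (intro mult_left_mono) (auto simp: stab_region_def atMost_atLeast0)
  also have "\<dots> \<le> \<rho> + real p" using norm_triangle_ineq4[of z "of_nat p"] by (simp add: \<rho>_def)
  finally show False using \<rho> by simp
qed

section \<open>Amplification by the remaining Euler steps\<close>

lemma partial_sum_le_exp:
  fixes x :: real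
  assumes "x \<ge> 0"
  shows "(\<Sum>k<n. x ^ k / fact k) \<le> exp x"
proof -
  obtain t where "exp x = (\<Sum>k<n. x ^ k / fact k) + exp t / fact n * x ^ n"
    using Maclaurin_exp_le by blast
  then show ?thesis using assms by simp
qed

text \<open>The cubic Taylor polynomial of \<open>exp u\<close> exceeds \<open>1 + u\<^sup>2\<close> by \<open>u\<close> times a positive quadratic.\<close>

lemma one_plus_square_le_exp:
  fixes u :: real
  assumes "u \<ge> 0"
  shows "1 + u\<^sup>2 \<le> exp u"
proof -
  have "u * ((u - 3/2)\<^sup>2 + 15/4) \<ge> 0" using assms by simp
  then have "1 + u\<^sup>2 \<le> (\<Sum>k<4. u ^ k / fact k)"
    by (simp add: eval_nat_numeral fact_numeral algebra_simps)
  also have "\<dots> \<le> exp u" using assms by (rule partial_sum_le_exp)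
  finally show ?thesis .
qed

text \<open>The exponential bound makes the power at most \<open>exp (\<bar>z\<bar>(m-1)/(2m))\<close>, so that small values of
  \<open>m\<close>, for which \<open>1 + z/m\<close> can be large, cause no loss. As \<open>(m-1)/m \<le> (p-1)/p\<close>, the exponent
  that results is \<open>p - 1\<close> and not \<open>p\<close>.\<close>

lemma euler_amplification_le:
  assumes z: "Re z \<le> 0" "cmod z \<le> 6/5 * real p" and "1 \<le> l" "l \<le> m" "m \<le> p"
  shows "cmod (1 + z / of_nat m) ^ (m - l) \<le> exp (3/5) ^ (p - 1)"
proof -
  define u where "u = cmod z / real m"
  have m: "real m > 0" using assms by simp
  have u: "u \<ge> 0" by (simp add: u_def)
  have "(cmod (1 + z / of_nat m))\<^sup>2 = 1 + 2 * Re z / real m + u\<^sup>2"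
    using m unfolding cmod_power2 u_def power_divide
    by (simp add: Re_divide_of_nat Im_divide_of_nat power2_eq_square field_simps)
  also have "\<dots> \<le> 1 + u\<^sup>2" using z(1) m by (simp add: divide_nonpos_pos)
  also have "\<dots> \<le> exp u" by (rule one_plus_square_le_exp[OF u])
  also have "\<dots> = (exp (u / 2))\<^sup>2" by (simp add: exp_double[symmetric])
  finally have "cmod (1 + z / of_nat m) \<le> exp (u / 2)" by (rule power2_le_imp_le) simp
  then have "cmod (1 + z / of_nat m) ^ (m - l) \<le> exp (u / 2) ^ (m - l)"
    by (intro power_mono) auto
  also have "\<dots> \<le> exp (u / 2) ^ (m - 1)" using u assms by (intro power_increasing) auto
  also have "\<dots> = exp (real (m - 1) * (u / 2))" by (simp only: exp_of_nat_mult)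
  also have "\<dots> \<le> exp (real (p - 1) * (3/5))"
  proof -
    have "real (m - 1) / real m * cmod z \<le> real (m - 1) / real m * (6/5 * real p)"
      by (intro mult_left_mono z(2)) simp
    also have "\<dots> \<le> 6/5 * real (p - 1)"
      using m assms by (simp add: of_nat_diff field_simps)
    finally have "real (m - 1) / real m * cmod z / 2 \<le> 6/5 * real (p - 1) / 2"
      by (rule divide_right_mono) simp
    then have "real (m - 1) * (u / 2) \<le> real (p - 1) * (3/5)" by (simp add: u_def)
    then show ?thesis by simp
  qed
  also have "\<dots> = exp (3/5) ^ (p - 1)" by (simp only: exp_of_nat_mult)
  finally show ?thesis .
qed

section \<open>A lower bound of Stirling type for the factorial\<close>

text \<open>The correction \<open>1/(12n)\<close> makes the left-hand side minus the right-hand side increasing in \<open>n\<close>, and the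
  constant \<open>11/12\<close> gives equality at \<open>n = 1\<close>. The induction step is the classical estimate
  \<open>(n + 1/2) ln (1 + 1/n) \<le> 1 + 1/(12n(n+1))\<close>, obtained from the expansion of
  \<open>ln ((1+y)/(1-y))\<close> at \<open>y = 1/(2n+1)\<close>.\<close>

lemma ln_fact_lower_bound:
  assumes "n \<ge> 1"
  shows "ln (fact n) \<ge> 11/12 + 1 / (12 * real n) + (real n + 1/2) * ln (real n) - real n"
  using assms
proof (induction n rule: nat_induct_at_least)
  case base
  show ?case by simp
next
  case (Suc n)
  define x :: real where "x = real n"
  have x: "x \<ge> 1" using Suc.hyps by (simp add: x_def)
  define y where "y = (((x + 1) / x) - 1) / (((x + 1) / x) + 1)"
  have y: "y = 1 / (2 * x + 1)" using x unfolding y_def by (simp add: field_simps)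
  have "ln ((x + 1) / x) \<le> (\<Sum>k<1. 2 * y ^ (2*k+1) / of_nat (2*k+1))
          + 2 * (y ^ (2*1+1) / of_nat (2*1+1) / (1 - y^2))"
    using ln_approx_bounds[of "(x + 1) / x" 1] x unfolding y_def by (auto simp: field_simps)
  also have "\<dots> = 2 * y + 2 * y^3 / 3 / (1 - y^2)" by (simp add: eval_nat_numeral)
  finally have L: "ln (x + 1) - ln x \<le> 2 * y + 2 * y^3 / 3 / (1 - y^2)"
    using x by (simp add: ln_div)
  have yy: "1 - y^2 = 4 * x * (x + 1) * y^2"
  proof -
    have "(2 * x + 1) * y = 1" using x unfolding y by simp
    then show ?thesis by algebra
  qed
  have "(x + 1/2) * (2 * y + 2 * y^3 / 3 / (1 - y^2)) = 1 + 1 / (12 * x * (x + 1))"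
    using x unfolding yy unfolding y by (simp add: divide_simps) (simp add: algebra_simps eval_nat_numeral)
  moreover have "1 / (12 * x * (x + 1)) = 1 / (12 * x) - 1 / (12 * (x + 1))"
    using x by (simp add: divide_simps)
  moreover have "(x + 1/2) * (ln (x + 1) - ln x) \<le> (x + 1/2) * (2 * y + 2 * y^3 / 3 / (1 - y^2))"
    using x by (intro mult_left_mono L) auto
  ultimately have K: "(x + 1/2) * (ln (x + 1) - ln x) \<le> 1 + 1 / (12 * x) - 1 / (12 * (x + 1))"
    by simp
  have "ln (fact (Suc n)) = ln (x + 1) + ln (fact n)"
    using x by (simp add: x_def ln_mult add.commute)
  then show ?case using K Suc.IH by (simp add: x_def algebra_simps)
qed

text \<open>The constant \<open>5/2\<close> replaces the optimal \<open>\<surd>(2\<pi>) = 2.506\<dots>\<close>; it lies just below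
  \<open>exp (11/12) = 2.5009\<dots>\<close>.\<close>

lemma fact_ge_stirling:
  assumes "n \<ge> 1"
  shows "5/2 * sqrt (real n) * real n ^ n \<le> fact n * exp (real n)"
proof -
  have "5/2 \<le> (\<Sum>k<7. (11/12::real) ^ k / fact k)"
    by (simp add: eval_nat_numeral fact_numeral)
  also have "\<dots> \<le> exp (11/12)" by (rule partial_sum_le_exp) simp
  finally have e: "5/2 \<le> exp (11/12::real)" .
  have n: "real n > 0" using assms by simp
  have "5/2 * sqrt (real n) * real n ^ n \<le> exp (11/12) * sqrt (real n) * real n ^ n"
    by (intro mult_right_mono e) auto
  also have "\<dots> = exp (11/12) * exp (ln (real n) / 2) * exp (real n * ln (real n))"
    using n by (simp add: ln_sqrt[symmetric] exp_of_nat_mult)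
  also have "\<dots> = exp (11/12 + (real n + 1/2) * ln (real n) - real n) * exp (real n)"
    unfolding exp_add[symmetric] by (simp add: algebra_simps)
  also have "\<dots> \<le> exp (ln (fact n)) * exp (real n)"
  proof -
    have "1 / (12 * real n) \<ge> 0" by simp
    then have "11/12 + (real n + 1/2) * ln (real n) - real n \<le> ln (fact n)"
      using ln_fact_lower_bound[OF assms] by linarith
    then show ?thesis by (intro mult_right_mono) (simp_all only: exp_le_cancel_iff exp_ge_zero)
  qed
  finally show ?thesis by simp
qed

section \<open>The growth of the extrapolation weights\<close>

text \<open>The number \<open>195/701\<close> is \<open>1.95/7.01\<close>. It is so close to \<open>W(1/e) = 0.27846\<dots>\<close>
  that \<open>exp (195/701)\<close> is needed to three decimals.\<close>

lemma Lambert_W_inverse_e: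
  defines "w \<equiv> Lambert_W (1 / exp 1)"
  shows "w * exp (1 + w) = 1" and "w > 195/701"
proof -
  have "-1 / exp 1 \<le> 1 / exp (1::real)" by (simp add: divide_right_mono)
  from theI'[OF Lambert_W_ex1[OF this]]
  have "w * exp w = 1 / exp 1" unfolding w_def Lambert_W_def by blast
  then show eq: "w * exp (1 + w) = 1" by (simp add: exp_add field_simps)
  show "w > 195/701"
  proof (rule ccontr)
    assume "\<not> ?thesis"
    then have le: "w \<le> 195/701" by simp
    define x :: real where "x = 195/701"
    have "\<bar>exp x - (\<Sum>i\<le>4. x ^ i / fact i)\<bar> \<le> exp x * x ^ 5 / fact 4"
      using Taylor_exp_field[of x 4] by (simp add: x_def eval_nat_numeral)
    then have "exp x * (1 - x ^ 5 / fact 4) \<le> (\<Sum>i\<le>4. x ^ i / fact i)"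
      by (simp add: algebra_simps)
    then have ex: "exp x \<le> 13216/10000"
      unfolding x_def by (simp add: eval_nat_numeral fact_numeral)
    have "w \<le> x" using le by (simp add: x_def)
    have "1 = w * exp (1 + w)" using eq by simp
    also have "\<dots> \<le> x * exp (1 + x)" using \<open>w \<le> x\<close> by (intro mult_mono) (auto simp: x_def)
    also have "\<dots> = x * (exp 1 * exp x)" by (simp add: exp_add)
    also have "\<dots> \<le> x * (272/100 * (13216/10000))"
      using ex e_less_272 by (intro mult_left_mono mult_mono) (auto simp: x_def)
    also have "\<dots> < 1" by (simp add: x_def)
    finally show False by simp
  qed
qed

text \<open>With \<open>t = m/k\<close> this is the tangent inequality \<open>w t \<le> exp (w t - 1)\<close>, raised to the power \<open>k\<close>; the
  equation for \<open>w\<close> converts its left-hand side into \<open>t\<close>. Equality would require \<open>w t = 1\<close>, which is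
  the stationary point of the growth rate of the weights.\<close>

lemma power_le_power_times_exp:
  fixes w :: real
  assumes w: "w * exp (1 + w) = 1" and "k \<ge> 1"
  shows "real m ^ k \<le> real k ^ k * exp (w * real (m + k))"
proof -
  have k: "real k > 0" using assms by simp
  define t where "t = real m / real k"
  have "t = (w * t) * exp (1 + w)" using w by (simp add: mult_ac)
  also have "\<dots> \<le> exp (w * t - 1) * exp (1 + w)"
    using exp_ge_add_one_self[of "w * t - 1"] by (intro mult_right_mono) auto
  also have "\<dots> = exp (w * (t + 1))" by (simp add: exp_add[symmetric] algebra_simps)
  finally have "t ^ k \<le> exp (w * (t + 1)) ^ k" by (intro power_mono) (auto simp: t_def)
  also have "\<dots> = exp (w * real (m + k))"
    using k unfolding exp_of_nat_mult[symmetric] t_def by (simp add: field_simps)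
  finally show ?thesis using k by (simp add: t_def power_divide field_simps)
qed

text \<open>Every power of \<open>e\<close> from Stirling's formula is rewritten by \<open>e = exp (-w)/w\<close>. For \<open>m < p\<close> the
  factor \<open>exp (-w p)\<close> cancels against the growth of \<open>(m/(p-m))\<^bsup>p-m\<^esup>\<close> and leaves the constant
  \<open>4/25 = (5/2)\<^bsup>-2\<^esup>\<close>. For \<open>m = p\<close> one Stirling factor is missing, but
  \<open>exp (-w p) \<le> exp (-3w) \<le> 11/25\<close> remains, which leaves \<open>22/125 = (2/5) * (11/25)\<close>.\<close>

lemma extrapolation_weight_le:
  fixes w :: real
  assumes w: "w * exp (1 + w) = 1" "w > 195/701" and "p \<ge> 3" "1 \<le> m" "m \<le> p"
  shows "real m ^ p / (fact m * fact (p - m)) \<le> 22/125 / (w ^ p * sqrt (real p - 1))"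
proof -
  have pos: "w > 0" "sqrt (real p - 1) > 0" using assms by auto
  have "exp 1 = exp (- w) / w" using w(1) pos by (simp add: exp_add exp_minus field_simps)
  then have "exp 1 ^ p = (exp (- w) / w) ^ p" by simp
  then have e: "exp (real p) = exp (- w * real p) / w ^ p"
    by (simp add: power_divide exp_of_nat_mult[symmetric] mult.commute)
  show ?thesis
  proof (cases "m = p")
    case True
    have "25/11 \<le> (\<Sum>k<4. (585/701::real) ^ k / fact k)"
      by (simp add: eval_nat_numeral fact_numeral)
    also have "\<dots> \<le> exp (585/701)" by (rule partial_sum_le_exp) simp
    also have "\<dots> \<le> exp (w * real p)"
    proof -
      have "195/701 * 3 \<le> w * real p" using w assms by (intro mult_mono) auto
      then show ?thesis by simp
    qed
    finally have ew: "exp (- w * real p) \<le> 11/25" by (simp add: exp_minus field_simps)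
    have "5/2 * sqrt (real p - 1) * real p ^ p \<le> 5/2 * sqrt (real p) * real p ^ p"
      by (intro mult_right_mono mult_left_mono) auto
    also have "\<dots> \<le> fact p * exp (real p)" using assms by (intro fact_ge_stirling) auto
    also have "\<dots> \<le> fact p * (11/25 / w ^ p)"
      unfolding e using ew pos by (intro mult_left_mono divide_right_mono) auto
    finally have "real p ^ p / fact p \<le> 22/125 / (w ^ p * sqrt (real p - 1))"
      using pos by (simp add: field_simps)
    then show ?thesis using True by simp
  next
    case False
    define k where "k = p - m"
    have k: "k \<ge> 1" "p = m + k" using False assms by (auto simp: k_def)
    \<comment> \<open>The product \<open>m (p - m)\<close> is smallest at the ends \<open>m = 1\<close> and \<open>m = p - 1\<close>.\<close>
    have mk: "real p - 1 \<le> real m * real k"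
    proof -
      have "0 \<le> (real m - 1) * (real k - 1)" using k assms by simp
      then show ?thesis using k by (simp add: algebra_simps)
    qed
    have "25/4 * sqrt (real p - 1) * real m ^ m * real k ^ k
        \<le> 25/4 * sqrt (real m * real k) * real m ^ m * real k ^ k"
      using mk by (intro mult_right_mono mult_left_mono) auto
    also have "\<dots> = (5/2 * sqrt (real m) * real m ^ m) * (5/2 * sqrt (real k) * real k ^ k)"
      by (simp add: real_sqrt_mult)
    also have "\<dots> \<le> (fact m * exp (real m)) * (fact k * exp (real k))"
      using k assms by (intro mult_mono fact_ge_stirling) auto
    also have "\<dots> = fact m * fact k * exp (real p)" by (simp add: k exp_add)
    finally have A: "25/4 * sqrt (real p - 1) * real m ^ m * real k ^ k
        \<le> fact m * fact k * (exp (- w * real p) / w ^ p)" unfolding e .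
    have "25/4 * sqrt (real p - 1) * real m ^ p = 25/4 * sqrt (real p - 1) * real m ^ m * real m ^ k"
      by (simp add: k power_add)
    also have "\<dots> \<le> 25/4 * sqrt (real p - 1) * real m ^ m * (real k ^ k * exp (w * real p))"
      using power_le_power_times_exp[OF w(1) k(1), of m] pos k(2) by (intro mult_left_mono) auto
    also have "\<dots> = (25/4 * sqrt (real p - 1) * real m ^ m * real k ^ k) * exp (w * real p)"
      by simp
    also have "\<dots> \<le> fact m * fact k * (exp (- w * real p) / w ^ p) * exp (w * real p)"
      by (intro mult_right_mono A) auto
    also have "\<dots> = fact m * fact k / w ^ p" by (simp add: exp_minus)
    finally have "real m ^ p / (fact m * fact k) \<le> 4/25 / (w ^ p * sqrt (real p - 1))"
      using pos by (simp add: field_simps)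
    also have "\<dots> \<le> 22/125 / (w ^ p * sqrt (real p - 1))"
      using pos by (intro divide_right_mono) auto
    finally show ?thesis unfolding k_def .
  qed
qed

section \<open>The bound on the internal stability polynomials\<close>

text \<open>The factor \<open>9/10\<close> below \<open>1.95\<^sup>n\<close> compensates for the surplus of \<open>22/125\<close> over \<open>1/(2\<pi>)\<close>.\<close>

lemma exp_three_fifths_power_le:
  assumes "n \<ge> 2"
  shows "exp (3/5) ^ n \<le> 9/10 * (39/20 :: real) ^ n"
proof -
  \<comment> \<open>Fifth powers reduce the estimate to one of \<open>e\<^sup>3\<close>.\<close>
  have "exp (3/5 :: real) ^ 5 = exp 1 ^ 3" by (simp add: exp_of_nat_mult[symmetric])
  also have "\<dots> \<le> (272/100) ^ 3" using e_less_272 by (intro power_mono) auto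
  also have "\<dots> \<le> (183/100) ^ 5" by (simp add: eval_nat_numeral)
  finally have "exp (3/5 :: real) \<le> 183/100" by (rule power_le_imp_le_base[of _ 4, simplified]) simp
  then have "exp (3/5) ^ n \<le> (183/100 :: real) ^ n" by (intro power_mono) auto
  also have "\<dots> = (61/65) ^ n * (39/20) ^ n" by (simp add: power_mult_distrib[symmetric])
  also have "\<dots> \<le> (61/65) ^ 2 * (39/20) ^ n"
    using assms by (intro mult_right_mono power_decreasing) auto
  also have "\<dots> \<le> 9/10 * (39/20 :: real) ^ n" by (intro mult_right_mono) (auto simp: power2_eq_square)
  finally show ?thesis .
qed

theorem theorem4p14:
  fixes p :: nat
  assumes "p \<ge> 3"
  shows "ee_M p (stab_region p \<inter> left_half_plane)
           \<le> ereal ((1.95 / Lambert_W (1 / exp 1)) ^ p / (3.9 * pi * sqrt (real p - 1)))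
       \<and> (1.95 / Lambert_W (1 / exp 1)) ^ p / (3.9 * pi * sqrt (real p - 1))
           < 7.01 ^ p / (3.9 * pi * sqrt (real p - 1))"
proof
  define w where "w = Lambert_W (1 / exp 1)"
  define B where "B = (1.95 / w) ^ p / (3.9 * pi * sqrt (real p - 1))"
  note w = Lambert_W_inverse_e[folded w_def]
  have pos: "w > 0" "sqrt (real p - 1) > 0" using w assms by auto
  have bound: "cmod (poly (ee_Q p m l) z) \<le> B"
    if z: "z \<in> stab_region p \<inter> left_half_plane" and ml: "1 \<le> l" "l \<le> m" "m \<le> p" for z m l
  proof -
    have "cmod (poly (ee_Q p m l) z) =
        real m ^ p / (fact m * fact (p - m)) * cmod (1 + z / of_nat m) ^ (m - l)"
      unfolding ee_Q_closed_form[OF ml] by (simp add: norm_mult norm_divide norm_power)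
    also have "\<dots> \<le> 22/125 / (w ^ p * sqrt (real p - 1)) * exp (3/5) ^ (p - 1)"
      using z ml assms pos w
      by (intro mult_mono extrapolation_weight_le euler_amplification_le stab_region_norm_le)
         (auto simp: left_half_plane_def)
    also have "\<dots> \<le> 22/125 / (w ^ p * sqrt (real p - 1)) * (9/10 * (39/20) ^ (p - 1))"
      using assms pos by (intro mult_left_mono exp_three_fifths_power_le) auto
    also have "\<dots> = 22/125 * (9/10) * (39/10 * pi) * (39/20) ^ (p - 1)
        / (39/10 * pi * (w ^ p * sqrt (real p - 1)))"
      using pos by simp
    also have "\<dots> \<le> 39/20 * (39/20) ^ (p - 1) / (39/10 * pi * (w ^ p * sqrt (real p - 1)))"
      using pi_approx(2) pos by (intro divide_right_mono mult_right_mono) auto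
    also have "\<dots> = B"
    proof -
      have "39/20 * (39/20 :: real) ^ (p - 1) = (39/20) ^ p"
        using assms by (cases p) auto
      then show ?thesis unfolding B_def by (simp add: power_divide mult_ac)
    qed
    finally show ?thesis .
  qed
  show "ee_M p (stab_region p \<inter> left_half_plane)
      \<le> ereal ((1.95 / Lambert_W (1 / exp 1)) ^ p / (3.9 * pi * sqrt (real p - 1)))"
    unfolding w_def[symmetric] B_def[symmetric] ee_M_def
    using assms bound by (auto intro!: SUP_least)
  have "1.95 / w < 7.01" using w pos by (simp add: field_simps)
  then have "(1.95 / w) ^ p < 7.01 ^ p" using assms pos by (intro power_strict_mono) auto
  then show "(1.95 / Lambert_W (1 / exp 1)) ^ p / (3.9 * pi * sqrt (real p - 1))
      < 7.01 ^ p / (3.9 * pi * sqrt (real p - 1))"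
    unfolding w_def[symmetric] using pos by (intro divide_strict_right_mono) auto
qed

end
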